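(* Let $x>1$, let $m,v\ge 0$ and $n\ge 1$ be integers, and let $k$ be an integer with $1\le k\le v$. Let $\alpha_0,\alpha_1,\dots,\alpha_m$ be real numbers. Then $$b_2(v,x;m,k,n;\alpha_0,\dots,\alpha_m)=\sum_{j=0}^{m}\alpha_j\sum_{l=0}^{j}\binom{j}{l}\left(-\frac{2k}{n}\right)^{j-l}\sum_{c=0}^{l}\binom{l}{c}\sum_{d=0}^{c}\binom{v}{d}\frac{d!\,\mathcal{S}_2(c,d)}{k^c}\left(\frac{1+x}{2}\right)^{d}c_k(v-d,x),$$ where terms with $d>v$ are understood to be $0$.
   Context: For $\beta\in\mathbb{C}$ and an integer $r\ge 0$, $(\beta)^{\overline{r}}=\prod_{j=0}^{r-1}(\beta+j)$, with $(\beta)^{\overline{0}}=1$. The generalized hypergeometric function is $${}_pF_q\left[\begin{array}{c}\beta_1,\dots,\beta_p\\ \gamma_1,\dots,\gamma_q\end{array};z\right]=\sum_{r=0}^{\infty}\frac{\prod_{j=1}^{p}(\beta_j)^{\overline{r}}}{\prod_{j=1}^{q}(\gamma_j)^{\overline{r}}}\frac{z^r}{r!},\qquad {}_0F_0(z)=e^z.$$ For integers $m\ge 0$, $k,n\ge 1$, and real $t,x,\alpha_0,\dots,\alpha_m$, define $$S_2(t,x;m,k,n;\alpha_0,\dots,\alpha_m)=\frac{1}{k!}\left(\frac{1-x}{2}t\right)^{k}\sum_{j=0}^{m}\alpha_j\sum_{l=0}^{j}\binom{j}{l}\left(-\frac{2k}{n}\right)^{j-l}\,{}_lF_l\left[\begin{array}{c}k+1,\dots,k+1\\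 k,\dots,k\end{array};\frac{1+x}{2}t\right],$$ where in ${}_lF_l$ all $l$ upper parameters equal $k+1$ and all $l$ lower parameters equal $k$. This is entire in $t$, and the numbers $b_2$ are defined by the expansion $$S_2(t,x;m,k,n;\alpha_0,\dots,\alpha_m)=\sum_{v=0}^{\infty}b_2(v,x;m,k,n;\alpha_0,\dots,\alpha_m)\frac{t^v}{v!}.$$ The superoscillatory coefficients are $c_k(w,x)=\binom{w}{k}\left(\frac{1+x}{2}\right)^{w-k}\left(\frac{1-x}{2}\right)^{k}$ for integers $w\ge k$, and $c_k(w,x)=0$ for $0\le w<k$. The Stirling numbers of the second kind are $\mathcal{S}_2(c,d)=\frac{1}{d!}\sum_{v=0}^{d}\binom{d}{v}(-1)^v(d-v)^c$, with $0^0=1$. *)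

theory Defs
  imports "HOL-Analysis.Analysis" "HOL-Combinatorics.Stirling"
begin

definition hypergeo :: "'a list \<Rightarrow> 'a list \<Rightarrow> 'a \<Rightarrow> 'a::{banach, real_normed_field}"
  where "hypergeo bs cs z = eval_fps (fps_hypergeo bs cs 1) z"

lemma foldl_mult_eq_prod_list:
  "foldl (\<lambda>r a. r * f a) (c :: 'a::comm_monoid_mult) as = c * (\<Prod>a\<leftarrow>as. f a)"
  by (induction as arbitrary: c) (simp_all add: mult_ac)

lemma hypergeo_series:
  "hypergeo bs cs z =
     (\<Sum>r. (\<Prod>b\<leftarrow>bs. pochhammer b r) / (\<Prod>c\<leftarrow>cs. pochhammer c r) * z ^ r / fact r)"
  by (simp add: hypergeo_def eval_fps_def foldl_mult_eq_prod_list field_simps)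

definition S2 :: "real \<Rightarrow> real \<Rightarrow> nat \<Rightarrow> nat \<Rightarrow> nat \<Rightarrow> (nat \<Rightarrow> real) \<Rightarrow> real"
  where "S2 t x m k n \<alpha> =
    1 / fact k * ((1 - x) / 2 * t) ^ k *
    (\<Sum>j\<le>m. \<alpha> j * (\<Sum>l\<le>j. real (j choose l) * (- (2 * real k / real n)) ^ (j - l) *
       hypergeo (replicate l (real k + 1)) (replicate l (real k)) ((1 + x) / 2 * t)))"

text \<open>The coefficients are those of the everywhere convergent expansion of \<^const>\<open>S2\<close> in \<open>t\<close>;
  \<open>b2_sums\<close> below shows that for \<open>k \<ge> 1\<close> the description is not vacuous.\<close>

definition b2 :: "nat \<Rightarrow> real \<Rightarrow> nat \<Rightarrow> nat \<Rightarrow> nat \<Rightarrow> (nat \<Rightarrow> real) \<Rightarrow> real"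
  where "b2 v x m k n \<alpha> =
    (THE b. \<forall>t. (\<lambda>u. b u * (t ^ u / fact u)) sums S2 t x m k n \<alpha>) v"

definition superosc_coeff :: "nat \<Rightarrow> nat \<Rightarrow> real \<Rightarrow> real"
  where "superosc_coeff k w x =
    (if k \<le> w then real (w choose k) * ((1 + x) / 2) ^ (w - k) * ((1 - x) / 2) ^ k else 0)"

definition stirling2 :: "nat \<Rightarrow> nat \<Rightarrow> real"
  where "stirling2 c d =
    1 / fact d * (\<Sum>v\<le>d. real (d choose v) * (- 1) ^ v * real (d - v) ^ c)"

lemma summable_hypergeo_shift:
  fixes z :: real
  assumes "k \<ge> 1"
  shows "summable (\<lambda>r. fps_nth (fps_hypergeo (replicate l (real k + 1)) (replicate l (real k)) 1) r * z ^ r)"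
proof (rule summable_comparison_test)
  have poch: "pochhammer (real k + 1) r / pochhammer (real k) r = (real k + real r) / real k" for r
  proof -
    have "pochhammer (real k) r > 0" using assms by (intro pochhammer_pos) simp
    moreover have "real k * pochhammer (real k + 1) r = pochhammer (real k) r * (real k + real r)"
      by (metis pochhammer_rec pochhammer_Suc)
    ultimately show ?thesis using assms by (simp add: field_simps)
  qed
  have eq: "fps_nth (fps_hypergeo (replicate l (real k + 1)) (replicate l (real k)) 1) r
      = ((real k + real r) / real k) ^ l / fact r" for r
    by (simp add: foldl_mult_eq_prod_list poch[symmetric] power_divide)
  have "((real k + real r) / real k) ^ l \<le> fact l * exp 1 * exp 1 ^ r" for r
  proof -
    have "real r / real k \<le> real r / 1"
      using assms by (intro divide_left_mono) auto
    then have "(real k + real r) / real k \<le> 1 + real r"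
      using assms by (simp add: add_divide_distrib)
    then have "((real k + real r) / real k) ^ l \<le> (1 + real r) ^ l"
      by (intro power_mono) auto
    also have "\<dots> \<le> fact l * exp (1 + real r)"
    proof -
      have "(1 + real r) ^ l / fact l \<le> exp (1 + real r)"
        using sum_le_suminf[OF sums_summable[OF exp_converges[of "1 + real r"]], of "{l}"]
        by (simp add: exp_def divide_inverse mult.commute)
      then show ?thesis by (simp add: field_simps)
    qed
    also have "\<dots> = fact l * exp 1 * exp 1 ^ r"
      by (simp add: exp_add exp_of_nat_mult[symmetric])
    finally show ?thesis .
  qed
  then have "norm (fps_nth (fps_hypergeo (replicate l (real k + 1)) (replicate l (real k)) 1) r * z ^ r)
      \<le> fact l * exp 1 * exp 1 ^ r / fact r * \<bar>z\<bar> ^ r" for r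
    unfolding eq by (simp add: abs_mult power_abs) (intro mult_right_mono divide_right_mono, auto)
  then show "\<exists>N. \<forall>r\<ge>N. norm (fps_nth (fps_hypergeo (replicate l (real k + 1)) (replicate l (real k)) 1) r * z ^ r)
      \<le> fact l * exp 1 * (inverse (fact r) * (exp 1 * \<bar>z\<bar>) ^ r)"
    by (auto simp: field_simps)
  show "summable (\<lambda>r. fact l * exp 1 * (inverse (fact r) * (exp 1 * \<bar>z\<bar>) ^ r))"
    by (intro summable_mult summable_exp)
qed

lemma S2_expansion_exists:
  assumes "k \<ge> 1"
  shows "\<exists>b. \<forall>t. (\<lambda>u. b u * (t ^ u / fact u)) sums S2 t x m k n \<alpha>"
proof -
  define f where "f l = fps_nth (fps_hypergeo (replicate l (real k + 1)) (replicate l (real k)) 1)" for l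
  define a where "a r = (\<Sum>j\<le>m. \<alpha> j * (\<Sum>l\<le>j. real (j choose l) * (- (2 * real k / real n)) ^ (j - l) *
       (f l r * ((1 + x) / 2) ^ r)))" for r
  define C where "C = 1 / fact k * ((1 - x) / 2) ^ k"
  define b where "b u = (if u < k then 0 else fact u * (C * a (u - k)))" for u
  have "(\<lambda>u. b u * (t ^ u / fact u)) sums S2 t x m k n \<alpha>" for t
  proof -
    have h: "(\<lambda>r. f l r * ((1 + x) / 2 * t) ^ r) sums
        hypergeo (replicate l (real k + 1)) (replicate l (real k)) ((1 + x) / 2 * t)" for l
      unfolding f_def hypergeo_def eval_fps_def
      by (rule summable_sums[OF summable_hypergeo_shift[OF assms]])
    have pw: "((1 - x) / 2 * t) ^ k = ((1 - x) / 2) ^ k * t ^ k"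
      "((1 + x) / 2 * t) ^ r = ((1 + x) / 2) ^ r * t ^ r" for r
      by (rule power_mult_distrib)+
    have "(\<lambda>r. 1 / fact k * ((1 - x) / 2 * t) ^ k *
        (\<Sum>j\<le>m. \<alpha> j * (\<Sum>l\<le>j. real (j choose l) * (- (2 * real k / real n)) ^ (j - l) *
          (f l r * ((1 + x) / 2 * t) ^ r)))) sums S2 t x m k n \<alpha>"
      unfolding S2_def by (intro sums_mult sums_sum h)
    also have "(\<lambda>r. 1 / fact k * ((1 - x) / 2 * t) ^ k *
        (\<Sum>j\<le>m. \<alpha> j * (\<Sum>l\<le>j. real (j choose l) * (- (2 * real k / real n)) ^ (j - l) *
          (f l r * ((1 + x) / 2 * t) ^ r)))) = (\<lambda>r. b (r + k) * (t ^ (r + k) / fact (r + k)))"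
      unfolding pw by (simp add: b_def C_def a_def power_add sum_distrib_left sum_distrib_right mult_ac)
    finally show ?thesis
      by (subst (asm) sums_zero_iff_shift) (simp_all add: b_def)
  qed
  then show ?thesis by blast
qed

lemma eval_fps_zero_imp_nth_zero:
  fixes p :: "real fps"
  assumes "fps_conv_radius p = \<infinity>" and "\<And>t. eval_fps p t = 0"
  shows "fps_nth p n = 0"
  using assms
proof (induction n arbitrary: p)
  case 0
  then show ?case using eval_fps_at_0[of p] by simp
next
  case (Suc n)
  have "fps_conv_radius (fps_deriv p) = \<infinity>"
    using fps_conv_radius_deriv[of p] Suc.prems(1) by (simp add: top_ereal_def[symmetric] top_unique)
  moreover have "eval_fps (fps_deriv p) t = 0" for t
  proof -
    have "(eval_fps p has_field_derivative eval_fps (fps_deriv p) t) (at t)"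
      using Suc.prems(1) by (intro has_field_derivative_eval_fps) simp
    moreover have "(eval_fps p has_field_derivative 0) (at t)"
      using Suc.prems(2) by (simp add: eval_fps_def[abs_def])
    ultimately show ?thesis by (rule DERIV_unique)
  qed
  ultimately have "fps_nth (fps_deriv p) n = 0" by (rule Suc.IH)
  then show ?case by simp
qed

lemma expansion_unique:
  fixes b b' :: "nat \<Rightarrow> real"
  assumes "\<And>t. (\<lambda>u. b u * (t ^ u / fact u)) sums F t"
    and "\<And>t. (\<lambda>u. b' u * (t ^ u / fact u)) sums F t"
  shows "b = b'"
proof
  fix u
  have s: "(\<lambda>u. (b u - b' u) / fact u * t ^ u) sums 0" for t
    using sums_diff[OF assms(1)[of t] assms(2)[of t]] by (simp add: field_simps)
  define p where "p = Abs_fps (\<lambda>u. (b u - b' u) / fact u)"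
  have "fps_conv_radius p = \<infinity>"
    unfolding fps_conv_radius_def p_def
    by (rule conv_radius_inftyI''[OF sums_summable]) (use s in simp)
  moreover have "eval_fps p t = 0" for t
    using sums_unique[OF s[of t]] by (simp add: eval_fps_def p_def)
  ultimately have "fps_nth p u = 0"
    by (rule eval_fps_zero_imp_nth_zero)
  then have "(b u - b' u) / fact u = 0" by (simp add: p_def)
  then show "b u = b' u" by simp
qed

lemma b2_sums:
  assumes "k \<ge> 1"
  shows "(\<lambda>v. b2 v x m k n \<alpha> * (t ^ v / fact v)) sums S2 t x m k n \<alpha>"
proof -
  have "\<exists>!b. \<forall>t. (\<lambda>u. b u * (t ^ u / fact u)) sums S2 t x m k n \<alpha>"
    using S2_expansion_exists[OF assms]
    by (rule ex_ex1I) (rule expansion_unique, blast+)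
  from theI'[OF this] show ?thesis unfolding b2_def by blast
qed

lemma stirling2_eq_Stirling: "stirling2 c d = real (Stirling c d)"
proof -
  define T where "T c d = (\<Sum>v\<le>d. real (d choose v) * (- 1) ^ v * real (d - v) ^ c)" for c d
  define U where "U c d = (\<Sum>v\<le>d. real (d choose v) * (- 1) ^ v * real (Suc d - v) ^ c)" for c d
  have absorb: "real (Suc d choose v) * real (Suc d - v) = real (Suc d) * real (d choose v)"
    if "v \<le> d" for d v
  proof -
    have "Suc d * (d choose v) = (Suc d choose v) * (Suc d - v)"
      using binomial_absorb_comp[of "Suc d" v] by (simp add: mult.commute)
    then show ?thesis by (metis of_nat_mult)
  qed
  have T_U: "T (Suc c) (Suc d) = real (Suc d) * U c d" for c d
  proof -
    have "T (Suc c) (Suc d) = (\<Sum>v\<le>d. real (Suc d choose v) * (- 1) ^ v * real (Suc d - v) ^ Suc c)"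
      unfolding T_def by simp
    also have "\<dots> = (\<Sum>v\<le>d. real (Suc d) * (real (d choose v) * (- 1) ^ v * real (Suc d - v) ^ c))"
    proof (rule sum.cong)
      fix v assume "v \<in> {..d}"
      then have "real (Suc d choose v) * real (Suc d - v) = real (Suc d) * real (d choose v)"
        using absorb by simp
      then show "real (Suc d choose v) * (- 1) ^ v * real (Suc d - v) ^ Suc c =
          real (Suc d) * (real (d choose v) * (- 1) ^ v * real (Suc d - v) ^ c)"
        by (metis (no_types, opaque_lifting) mult.assoc mult.left_commute power_Suc)
    qed simp
    finally show ?thesis by (simp add: U_def sum_distrib_left)
  qed
  have U_T: "U c d = T c (Suc d) + T c d" for c d
  proof -
    have "T c (Suc d) = real (Suc d) ^ c +
        (\<Sum>v\<le>d. real (Suc d choose Suc v) * (- 1) ^ Suc v * real (d - v) ^ c)"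
      unfolding T_def by (subst sum.atMost_Suc_shift) simp
    also have "\<dots> = real (Suc d) ^ c +
        (\<Sum>v\<le>d. real (d choose Suc v) * (- 1) ^ Suc v * real (d - v) ^ c) - T c d"
    proof -
      have "real (Suc d choose Suc v) * (- 1) ^ Suc v * real (d - v) ^ c =
          real (d choose Suc v) * (- 1) ^ Suc v * real (d - v) ^ c -
          real (d choose v) * (- 1) ^ v * real (d - v) ^ c" for v
        by (simp add: ring_distribs)
      then show ?thesis by (simp only: T_def sum_subtractf add_diff_eq)
    qed
    also have "real (Suc d) ^ c +
        (\<Sum>v\<le>d. real (d choose Suc v) * (- 1) ^ Suc v * real (d - v) ^ c) =
        (\<Sum>v\<le>Suc d. real (d choose v) * (- 1) ^ v * real (Suc d - v) ^ c)"
      by (subst sum.atMost_Suc_shift) simp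
    also have "\<dots> = U c d"
      by (simp add: U_def)
    finally show ?thesis by simp
  qed
  have "T c d = fact d * real (Stirling c d)"
  proof (induction c d rule: Stirling.induct)
    case (2 d)
    have "T 0 (Suc d) = 0"
      using choose_alternating_sum[of "Suc d", where 'a = real] by (simp add: T_def mult.commute)
    then show ?case by simp
  next
    case (4 c d)
    then show ?case by (simp add: T_U U_T algebra_simps)
  qed (simp_all add: T_def)
  then show ?thesis by (simp add: stirling2_def T_def)
qed

end

theory Submission
  imports Defs
begin

text \<open>
  The idea is to compute the coefficient of \<open>t ^ v / v!\<close> explicitly.  The ratio of rising
  factorials of \<open>k + 1\<close> and \<open>k\<close> telescopes to \<open>(k + r) / k\<close>, so the \<open>r\<close>-th term of each
  hypergeometric series is that of the exponential series times \<open>((k + r) / k) ^ l\<close>.  The prefactor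
  \<open>((1 - x) t / 2) ^ k / k!\<close> shifts the index to \<open>v = r + k\<close> and completes the exponential
  coefficient to \<open>c\<^sub>k(v, x)\<close>.  Hence each hypergeometric function of order \<open>l\<close> contributes
  \<open>(v / k) ^ l c\<^sub>k(v, x)\<close> (\<open>superosc_generating_function\<close>), and uniqueness of power series
  coefficients turns this into a closed form for \<open>b\<^sub>2\<close> (\<open>b2_closed_form\<close>).

  It remains to expand \<open>(v / k) ^ l\<close>.  Writing \<open>v / k = 1 + (v - k) / k\<close>, the binomial theorem
  gives the powers \<open>(v - k) ^ c\<close>, and Stirling numbers of the second kind convert these into falling
  factorials of \<open>v - k\<close> (\<open>power_eq_sum_Stirling_falling\<close>).  A falling factorial of \<open>v - k\<close> of
  order \<open>d\<close> is exactly what multiplies \<open>c\<^sub>k(v, x)\<close> when \<open>v\<close> is lowered to \<open>v - d\<close>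
  (\<open>superosc_coeff_lower\<close>), whence the sum over \<open>d\<close>.
\<close>

lemma pochhammer_Suc_ratio:
  fixes a :: real
  assumes "a > 0"
  shows "pochhammer (a + 1) r / pochhammer a r = (a + real r) / a"
proof -
  have "pochhammer a r > 0"
    using assms by (rule pochhammer_pos)
  moreover have "a * pochhammer (a + 1) r = pochhammer a r * (a + real r)"
    by (metis pochhammer_rec pochhammer_Suc)
  ultimately show ?thesis
    using assms by (simp add: field_simps)
qed

lemma hypergeo_shift_sums:
  fixes z :: real
  assumes "k \<ge> 1"
  shows "(\<lambda>r. ((real k + real r) / real k) ^ l * z ^ r / fact r) sums
    hypergeo (replicate l (real k + 1)) (replicate l (real k)) z"
proof -
  have "pochhammer (real k + 1) r / pochhammer (real k) r = (real k + real r) / real k" for r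
    using assms by (intro pochhammer_Suc_ratio) simp
  then have nth: "fps_nth (fps_hypergeo (replicate l (real k + 1)) (replicate l (real k)) 1) r
      = ((real k + real r) / real k) ^ l / fact r" for r
    by (simp add: foldl_mult_eq_prod_list power_divide[of "pochhammer (real k + 1) r", symmetric]
        flip: divide_divide_eq_left)
  show ?thesis
    using summable_sums[OF summable_hypergeo_shift[OF assms, of l z]]
    unfolding hypergeo_def eval_fps_def nth by simp
qed

text \<open>
  For \<open>l = 0\<close> this is the classical exponential generating function of \<open>c\<^sub>k(u, x)\<close> in \<open>u\<close>; raising
  \<open>l\<close> by one applies the operator \<open>(t / k) d/dt\<close>, which multiplies the \<open>u\<close>-th coefficient by
  \<open>u / k\<close>.
\<close>

lemma superosc_generating_function:
  assumes "k \<ge> 1"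
  shows "(\<lambda>u. (real u / real k) ^ l * superosc_coeff k u x * (t ^ u / fact u)) sums
    (1 / fact k * ((1 - x) / 2 * t) ^ k *
      hypergeo (replicate l (real k + 1)) (replicate l (real k)) ((1 + x) / 2 * t))"
proof -
  define g where "g u = (real u / real k) ^ l * superosc_coeff k u x * (t ^ u / fact u)" for u
  have "1 / fact k * ((1 - x) / 2 * t) ^ k *
      (((real k + real r) / real k) ^ l * ((1 + x) / 2 * t) ^ r / fact r) = g (r + k)" for r
  proof -
    have "real (r + k choose k) / fact (r + k) = 1 / (fact k * fact r)"
      by (simp add: binomial_fact)
    moreover have "g (r + k) = (real (r + k choose k) / fact (r + k)) *
        (((real k + real r) / real k) ^ l * (((1 + x) / 2) ^ r * t ^ r) *
          (((1 - x) / 2) ^ k * t ^ k))"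
      by (simp add: g_def superosc_coeff_def power_add add.commute)
    ultimately show ?thesis
      by (simp only: power_mult_distrib) simp
  qed
  with sums_mult[OF hypergeo_shift_sums[OF assms, of l "(1 + x) / 2 * t"],
      of "1 / fact k * ((1 - x) / 2 * t) ^ k"]
  have "(\<lambda>r. g (r + k)) sums (1 / fact k * ((1 - x) / 2 * t) ^ k *
      hypergeo (replicate l (real k + 1)) (replicate l (real k)) ((1 + x) / 2 * t))"
    by simp
  moreover have "g u = 0" if "u < k" for u
    using that by (simp add: g_def superosc_coeff_def)
  ultimately have "g sums (1 / fact k * ((1 - x) / 2 * t) ^ k *
      hypergeo (replicate l (real k + 1)) (replicate l (real k)) ((1 + x) / 2 * t))"
    by (simp add: sums_zero_iff_shift)
  then show ?thesis
    by (simp add: g_def[abs_def])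
qed

lemma b2_closed_form:
  assumes "k \<ge> 1"
  shows "b2 v x m k n \<alpha> =
    (\<Sum>j\<le>m. \<alpha> j * (\<Sum>l\<le>j. real (j choose l) * (- (2 * real k / real n)) ^ (j - l) *
      ((real v / real k) ^ l * superosc_coeff k v x)))"
proof -
  define e where "e u = (\<Sum>j\<le>m. \<alpha> j * (\<Sum>l\<le>j. real (j choose l) *
    (- (2 * real k / real n)) ^ (j - l) * ((real u / real k) ^ l * superosc_coeff k u x)))" for u
  have "(\<lambda>u. e u * (t ^ u / fact u)) sums S2 t x m k n \<alpha>" for t
  proof -
    have "(\<lambda>u. \<Sum>j\<le>m. \<alpha> j * (\<Sum>l\<le>j. real (j choose l) *
        (- (2 * real k / real n)) ^ (j - l) *
          ((real u / real k) ^ l * superosc_coeff k u x * (t ^ u / fact u)))) sums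
      (\<Sum>j\<le>m. \<alpha> j * (\<Sum>l\<le>j. real (j choose l) * (- (2 * real k / real n)) ^ (j - l) *
        (1 / fact k * ((1 - x) / 2 * t) ^ k *
          hypergeo (replicate l (real k + 1)) (replicate l (real k)) ((1 + x) / 2 * t))))"
      by (intro sums_sum sums_mult superosc_generating_function assms)
    then show ?thesis
      by (simp only: S2_def e_def sum_distrib_left sum_distrib_right mult_ac)
  qed
  with b2_sums[OF assms] have "(\<lambda>v. b2 v x m k n \<alpha>) = e"
    by (rule expansion_unique)
  then show ?thesis
    by (simp add: e_def fun_eq_iff)
qed

text \<open>
  The product \<open>d! (r choose d)\<close> is the falling factorial of \<open>r\<close> of order \<open>d\<close>.  Multiplying it by
  \<open>r = d + (r - d)\<close> gives \<open>d\<close> times itself plus the falling factorial of order \<open>d + 1\<close>, which is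
  the recurrence of the Stirling numbers of the second kind.
\<close>

lemma power_eq_sum_Stirling_falling:
  "real r ^ c = (\<Sum>d\<le>c. real (Stirling c d) * (fact d * real (r choose d)))"
proof (induction c)
  case 0
  show ?case by simp
next
  case (Suc c)
  define f where "f d = (fact d * real (r choose d) :: real)" for d
  have step: "real r * f d = real d * f d + f (Suc d)" for d
  proof -
    have "real (Suc d) * real (r choose Suc d) = (real r - real d) * real (r choose d)"
    proof (cases "d \<le> r")
      case True
      have "Suc d * (r choose Suc d) = (r - d) * (r choose d)"
        by (simp only: binomial_absorption binomial_absorb_comp)
      with True show ?thesis
        by (metis of_nat_diff of_nat_mult)
    qed (simp add: binomial_eq_0)
    then have "fact d * (real (Suc d) * real (r choose Suc d)) =
        fact d * ((real r - real d) * real (r choose d))"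
      by simp
    then show ?thesis
      by (simp add: f_def algebra_simps)
  qed
  have shift: "(\<Sum>d\<le>c. real (Suc d) * real (Stirling c (Suc d)) * f (Suc d)) =
      (\<Sum>d\<le>c. real (Stirling c d) * (real d * f d))"
  proof -
    have "(\<Sum>d\<le>c. real (Suc d) * real (Stirling c (Suc d)) * f (Suc d)) =
        (\<Sum>d\<le>Suc c. real d * real (Stirling c d) * f d)"
      by (subst sum.atMost_Suc_shift) simp
    then show ?thesis
      by (simp add: mult_ac)
  qed
  have "real r ^ Suc c = (\<Sum>d\<le>c. real (Stirling c d) * (real r * f d))"
    using Suc.IH by (simp add: f_def sum_distrib_left mult_ac)
  also have "\<dots> = (\<Sum>d\<le>c. real (Stirling c d) * (real d * f d)) +
      (\<Sum>d\<le>c. real (Stirling c d) * f (Suc d))"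
    by (simp add: step distrib_left sum.distrib)
  also have "\<dots> = (\<Sum>d\<le>c. real (Stirling (Suc c) (Suc d)) * f (Suc d))"
    by (simp only: shift[symmetric] sum.distrib[symmetric]) (simp add: algebra_simps)
  also have "\<dots> = (\<Sum>d\<le>Suc c. real (Stirling (Suc c) d) * f d)"
    by (subst sum.atMost_Suc_shift) simp
  finally show ?case
    by (simp add: f_def)
qed

text \<open>
  Up to the common powers of \<open>(1 \<plusminus> x) / 2\<close>, both sides count the pairs of disjoint
  subsets of sizes \<open>d\<close> and \<open>k\<close> of a set of size \<open>v\<close>: the left side chooses the \<open>d\<close> elements
  first, the right side the \<open>k\<close> elements.  There are none unless \<open>d + k \<le> v\<close>.
\<close>

lemma superosc_coeff_lower:
  assumes "k \<le> v"
  shows "real (v choose d) * ((1 + x) / 2) ^ d * superosc_coeff k (v - d) x =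
    real (v - k choose d) * superosc_coeff k v x"
proof (cases "d + k \<le> v")
  case True
  have "real (v choose d) * real (v - d choose k) = real (v - k choose d) * real (v choose k)"
  proof -
    have "v - d - k = v - k - d" by simp
    with True show ?thesis
      by (simp add: binomial_fact)
  qed
  moreover have "((1 + x) / 2) ^ d * ((1 + x) / 2) ^ (v - d - k) = ((1 + x) / 2) ^ (v - k)"
    using True by (simp flip: power_add)
  ultimately have "(real (v choose d) * real (v - d choose k)) *
      (((1 + x) / 2) ^ d * ((1 + x) / 2) ^ (v - d - k)) * ((1 - x) / 2) ^ k =
    (real (v - k choose d) * real (v choose k)) * ((1 + x) / 2) ^ (v - k) * ((1 - x) / 2) ^ k"
    by (simp only:)
  moreover have "superosc_coeff k (v - d) x =
      real (v - d choose k) * ((1 + x) / 2) ^ (v - d - k) * ((1 - x) / 2) ^ k"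
    using True by (simp add: superosc_coeff_def)
  moreover have "superosc_coeff k v x =
      real (v choose k) * ((1 + x) / 2) ^ (v - k) * ((1 - x) / 2) ^ k"
    using assms by (simp add: superosc_coeff_def)
  ultimately show ?thesis
    by (simp only: mult_ac)
next
  case False
  then have "superosc_coeff k (v - d) x = 0 \<or> v choose d = 0" and "v - k choose d = 0"
    using assms by (auto simp: superosc_coeff_def)
  then show ?thesis
    by (auto simp: binomial_eq_0)
qed

lemma superosc_coeff_Stirling_sum:
  assumes "k \<le> v"
  shows "(\<Sum>d\<le>c. if d \<le> v
      then real (v choose d) * (fact d * stirling2 c d / real k ^ c) *
             ((1 + x) / 2) ^ d * superosc_coeff k (v - d) x
      else 0) = (real (v - k) / real k) ^ c * superosc_coeff k v x"
proof -
  have "(if d \<le> v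
      then real (v choose d) * (fact d * stirling2 c d / real k ^ c) *
             ((1 + x) / 2) ^ d * superosc_coeff k (v - d) x
      else 0) =
    real (Stirling c d) * (fact d * real (v - k choose d)) * (superosc_coeff k v x / real k ^ c)"
    for d
  proof (cases "d \<le> v")
    case True
    have "real (v choose d) * (fact d * stirling2 c d / real k ^ c) *
        ((1 + x) / 2) ^ d * superosc_coeff k (v - d) x =
      (fact d * real (Stirling c d) / real k ^ c) *
        (real (v choose d) * ((1 + x) / 2) ^ d * superosc_coeff k (v - d) x)"
      by (simp only: stirling2_eq_Stirling mult_ac)
    also have "\<dots> = (fact d * real (Stirling c d) / real k ^ c) *
        (real (v - k choose d) * superosc_coeff k v x)"
      by (simp only: superosc_coeff_lower[OF assms])
    finally show ?thesis
      using True by simp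
  next
    case False
    then have "v - k choose d = 0" by simp
    with False show ?thesis by simp
  qed
  then show ?thesis
    by (simp only: power_divide power_eq_sum_Stirling_falling[of "v - k"] flip: sum_distrib_right)
      simp
qed

theorem theorem2p15:
  fixes x :: real and m v n k :: nat and \<alpha> :: "nat \<Rightarrow> real"
  assumes "x > 1" and "n \<ge> 1" and "1 \<le> k" and "k \<le> v"
  shows "b2 v x m k n \<alpha> =
    (\<Sum>j\<le>m. \<alpha> j * (\<Sum>l\<le>j. real (j choose l) * (- (2 * real k / real n)) ^ (j - l) *
      (\<Sum>c\<le>l. real (l choose c) *
        (\<Sum>d\<le>c. if d \<le> v
                 then real (v choose d) * (fact d * stirling2 c d / real k ^ c) *
                        ((1 + x) / 2) ^ d * superosc_coeff k (v - d) x
                 else 0))))"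
proof -
  have "(\<Sum>c\<le>l. real (l choose c) * ((real (v - k) / real k) ^ c * superosc_coeff k v x)) =
      (real v / real k) ^ l * superosc_coeff k v x" for l
  proof -
    have "real v / real k = real (v - k) / real k + 1"
      using assms by (simp add: of_nat_diff field_simps)
    then have "(real v / real k) ^ l = (\<Sum>c\<le>l. real (l choose c) * (real (v - k) / real k) ^ c)"
      by (simp add: binomial_ring)
    then show ?thesis
      by (simp add: sum_distrib_right mult.assoc)
  qed
  then show ?thesis
    by (simp only: b2_closed_form[OF \<open>1 \<le> k\<close>] superosc_coeff_Stirling_sum[OF \<open>k \<le> v\<close>])
qed

end
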